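(* As formal power series in $u$ with coefficients that are polynomials in the variables $x_1,x_2,\dots$, $$\sum_{n=0}^{\infty}\frac{u^{n+1}}{2^n}\sum_{\pi\in S_{b_2}^{(n+1)}}\ \prod_i x_i^{n_i(\pi)}=2\sum_{k\ge1}\left(\sum_{i\ge1}x_i\left(\frac u2\right)^i\right)^k .$$
   Context: For $N\ge1$, $S_{b_2}^{(N)}$ denotes the set of permutations $\pi$ of $\{1,\dots,N\}$ such that $\pi(i)\ge i-1$ for all $i\in\{2,\dots,N\}$. For a permutation $\pi$, $n_i(\pi)$ is the number of $i$-cycles of $\pi$ (fixed points are $1$-cycles). *)

theory Defs
  imports
    "HOL-Computational_Algebra.Formal_Power_Series"
    "HOL-Combinatorics.Combinatorics"
    "HOL-Library.Poly_Mapping"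
begin

(* Polynomials over 'a in the variables x_0, x_1, x_2, ...: finitely supported maps from
   monomials (finitely supported exponent vectors) to coefficients.  x_0 is never used. *)
type_synonym 'a mpoly = "(nat \<Rightarrow>\<^sub>0 nat) \<Rightarrow>\<^sub>0 'a"

definition mconst :: "'a::zero \<Rightarrow> 'a mpoly" where
  "mconst c = Poly_Mapping.single 0 c"

definition mvar :: "nat \<Rightarrow> 'a::zero_neq_one mpoly" where
  "mvar i = Poly_Mapping.single (Poly_Mapping.single i 1) 1"

definition S_b2 :: "nat \<Rightarrow> (nat \<Rightarrow> nat) set" where
  "S_b2 N = {\<pi>. \<pi> permutes {1..N} \<and> (\<forall>i\<in>{2..N}. \<pi> i \<ge> i - 1)}"

(* The set A on which p is regarded as a permutation must be given explicitly, since the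
   function p also fixes every point outside A, and those do not count as 1-cycles. *)
definition num_cycles :: "'b set \<Rightarrow> ('b \<Rightarrow> 'b) \<Rightarrow> nat \<Rightarrow> nat" where
  "num_cycles A p i = card {C. (\<exists>a\<in>A. C = orbit p a) \<and> card C = i}"

(* The product over all i >= 1 reduces to i <= N, as there are no longer cycles. *)
definition cycle_monomial :: "nat \<Rightarrow> (nat \<Rightarrow> nat) \<Rightarrow> 'a::comm_semiring_1 mpoly" where
  "cycle_monomial N \<pi> = (\<Prod>i\<in>{1..N}. mvar i ^ num_cycles {1..N} \<pi> i)"

end

theory Submission
  imports Defs
begin

text \<open>
  Write \<open>P N\<close> for the sum of the cycle monomials over \<^const>\<open>S_b2\<close> \<open>N\<close>.  The condition
  \<open>\<pi> i \<ge> i - 1\<close> is so rigid that the cycle through the largest point \<open>N\<close> must be an interval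
  \<open>{j + 1..N}\<close>, run through downwards: \<open>N\<close> is the image of some \<open>j + 1\<close>, and then, from the top,
  each \<open>i\<close> in \<open>{j + 2..N}\<close> has \<open>i - 1\<close> as the only value still available.  What remains is an
  arbitrary element of \<^const>\<open>S_b2\<close> \<open>j\<close> (so the permutations correspond to the compositions of
  \<open>N\<close>, the parts being the cycle lengths).  Splitting off this last cycle gives the recurrence
  \<open>P N = (\<Sum>j<N. x_(N - j) * P j)\<close> with \<open>P 0 = 1\<close>, proved in \<open>sum_cycle_monomial_rec\<close>.

  Let \<open>R = (\<Sum>i\<ge>1. x_i (u/2)^i)\<close> and \<open>Q = (\<Sum>N\<ge>0. (u/2)^N P N)\<close>.  The recurrence says
  \<open>Q = 1 + R Q\<close>, whence \<open>Q - 1 = R + R\<^sup>2 + R\<^sup>3 + \<dots>\<close> by \<open>sums_powers_fps\<close>, because \<open>R\<close> has no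
  constant term.  The left-hand side of the theorem is \<open>2 (Q - 1)\<close>, the factor 2 coming from the
  exponent \<open>n\<close>, in place of \<open>n + 1\<close>, of the denominator.
\<close>

section \<open>Splitting off the last cycle\<close>

definition append_cycle :: "nat \<Rightarrow> nat \<Rightarrow> (nat \<Rightarrow> nat) \<Rightarrow> nat \<Rightarrow> nat" where
  "append_cycle j N \<sigma> =
     (\<lambda>i. if i = Suc j then N else if Suc j < i \<and> i \<le> N then i - 1 else \<sigma> i)"

lemma append_cycle_permutes:
  assumes "\<sigma> permutes {1..j}" "j < N"
  shows "append_cycle j N \<sigma> permutes {1..N}"
proof -
  have low: "\<sigma> i \<in> {1..j}" if "i \<in> {1..j}" for i
    using that permutes_in_image[OF assms(1)] by blast
  have inj: "\<sigma> x = \<sigma> y \<longleftrightarrow> x = y" for x y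
    using permutes_inj[OF assms(1)] by (auto dest: injD)
  have sub: "append_cycle j N \<sigma> ` {1..N} \<subseteq> {1..N}"
  proof clarify
    fix i assume i: "i \<in> {1..N}"
    show "append_cycle j N \<sigma> i \<in> {1..N}"
      using i assms(2) low[of i] by (cases "i \<le> j") (auto simp: append_cycle_def)
  qed
  have "inj_on (append_cycle j N \<sigma>) {1..N}"
  proof (rule inj_onI)
    fix x y assume *: "x \<in> {1..N}" "y \<in> {1..N}" "append_cycle j N \<sigma> x = append_cycle j N \<sigma> y"
    show "x = y"
      using * assms(2) low[of x] low[of y] inj[of x y]
      by (cases "x \<le> j"; cases "y \<le> j") (auto simp: append_cycle_def split: if_splits)
  qed
  with sub have "bij_betw (append_cycle j N \<sigma>) {1..N} {1..N}"
    by (simp add: bij_betw_def endo_inj_surj)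
  moreover have "append_cycle j N \<sigma> x = x" if "x \<notin> {1..N}" for x
    using that assms permutes_not_in[OF assms(1), of x] by (auto simp: append_cycle_def)
  ultimately show ?thesis
    by (rule bij_imp_permutes)
qed

lemma append_cycle_in_S_b2:
  assumes "\<sigma> \<in> S_b2 j" "j < N"
  shows "append_cycle j N \<sigma> \<in> S_b2 N"
proof -
  have "append_cycle j N \<sigma> i \<ge> i - 1" if "i \<in> {2..N}" for i
    using that assms by (cases "i \<le> j") (auto simp: append_cycle_def S_b2_def)
  with assms show ?thesis
    using append_cycle_permutes[of \<sigma> j N] by (auto simp: S_b2_def)
qed

text \<open>The cycle through \<open>N\<close> is forced by descending from \<open>N\<close> to its preimage \<open>Suc j\<close>: for \<open>i\<close>
  above \<open>Suc j\<close>, the condition \<open>\<pi> i \<ge> i - 1\<close> leaves only the values in \<open>{i - 1..N}\<close>, of which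
  \<open>i..N - 1\<close> are taken by the points above \<open>i\<close>, and \<open>N\<close> by \<open>Suc j\<close>.  The interval
  of the cycle is then invariant, so \<open>\<pi>\<close> restricts to a permutation of the points below it.\<close>

lemma S_b2_eq_append_cycle:
  assumes "\<pi> \<in> S_b2 N" "N > 0"
  obtains j \<sigma> where "j < N" "\<sigma> \<in> S_b2 j" "\<pi> = append_cycle j N \<sigma>"
proof -
  have perm: "\<pi> permutes {1..N}" and ge: "\<And>i. i \<in> {2..N} \<Longrightarrow> \<pi> i \<ge> i - 1"
    using assms by (auto simp: S_b2_def)
  have inj: "\<pi> x = \<pi> y \<longleftrightarrow> x = y" for x y
    using permutes_inj[OF perm] by (auto dest: injD)
  have "N \<in> \<pi> ` {1..N}"
    using assms(2) permutes_image[OF perm] by auto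
  then obtain a where "a \<in> {1..N}" "\<pi> a = N" by auto
  then have "a - 1 < N" "\<pi> (Suc (a - 1)) = N" by auto
  then obtain j where j: "j < N" "\<pi> (Suc j) = N" by blast
  have range: "\<pi> i \<in> {1..N}" if "i \<in> {1..N}" for i
    using that permutes_in_image[OF perm] by blast
  have down: "\<pi> i = i - 1" if "Suc j < i" "i \<le> N" for i
    using that
  proof (induction "N - i" arbitrary: i rule: less_induct)
    case less
    have "\<pi> i \<le> N" using range[of i] less.prems by simp
    moreover have "\<pi> i \<noteq> N" using j inj[of i "Suc j"] less.prems by auto
    moreover have "\<not> i \<le> \<pi> i"
    proof
      assume "i \<le> \<pi> i"
      with \<open>\<pi> i \<le> N\<close> \<open>\<pi> i \<noteq> N\<close> less.prems have "\<pi> (Suc (\<pi> i)) = \<pi> i"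
        using less.hyps[of "Suc (\<pi> i)"] by simp
      with inj[of "Suc (\<pi> i)" i] \<open>i \<le> \<pi> i\<close> show False by simp
    qed
    moreover have "\<pi> i \<ge> i - 1" using ge[of i] less.prems by simp
    ultimately show ?case by simp
  qed
  define \<sigma> where "\<sigma> = (\<lambda>i. if i \<le> j then \<pi> i else i)"
  have low: "\<pi> i \<in> {1..j}" if "i \<in> {1..j}" for i
  proof (rule ccontr)
    assume "\<pi> i \<notin> {1..j}"
    with range[of i] that j have *: "Suc j \<le> \<pi> i" "\<pi> i \<le> N" by auto
    show False
    proof (cases "\<pi> i = N")
      case True
      with j inj[of i "Suc j"] that show False by simp
    next
      case False
      with * down[of "Suc (\<pi> i)"] inj[of "Suc (\<pi> i)" i] that show False by simp
    qed
  qed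
  have "inj_on \<sigma> {1..j}" by (auto simp: inj_on_def \<sigma>_def inj)
  moreover have "\<sigma> ` {1..j} \<subseteq> {1..j}" using low by (auto simp: \<sigma>_def)
  ultimately have "bij_betw \<sigma> {1..j} {1..j}"
    by (simp add: bij_betw_def endo_inj_surj)
  moreover have "\<sigma> x = x" if "x \<notin> {1..j}" for x
    using that permutes_not_in[OF perm, of x] by (auto simp: \<sigma>_def)
  ultimately have "\<sigma> permutes {1..j}" by (rule bij_imp_permutes)
  then have "\<sigma> \<in> S_b2 j" using ge j by (auto simp: S_b2_def \<sigma>_def)
  moreover have "\<pi> = append_cycle j N \<sigma>"
    using j down permutes_not_in[OF perm] by (auto simp: append_cycle_def \<sigma>_def fun_eq_iff)
  ultimately show thesis using j that by blast
qed

lemma bij_betw_append_cycle: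
  assumes "N > 0"
  shows "bij_betw (\<lambda>(j, \<sigma>). append_cycle j N \<sigma>) (SIGMA j:{..<N}. S_b2 j) (S_b2 N)"
  unfolding bij_betw_def
proof
  show "inj_on (\<lambda>(j, \<sigma>). append_cycle j N \<sigma>) (SIGMA j:{..<N}. S_b2 j)"
  proof (rule inj_onI, clarsimp)
    fix j \<sigma> j' \<sigma>'
    assume *: "j < N" "\<sigma> \<in> S_b2 j" "j' < N" "\<sigma>' \<in> S_b2 j'"
      and eq: "append_cycle j N \<sigma> = append_cycle j' N \<sigma>'"
    have perm: "\<sigma> permutes {1..j}" "\<sigma>' permutes {1..j'}"
      using * by (auto simp: S_b2_def)
    \<comment> \<open>The index \<open>j\<close> is recovered from the preimage \<open>Suc j\<close> of \<open>N\<close>.\<close>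
    have "append_cycle j N \<sigma> (Suc j) = N" by (simp add: append_cycle_def)
    moreover have "append_cycle j N \<sigma> (Suc j') = N" unfolding eq by (simp add: append_cycle_def)
    ultimately have j: "j = j'"
      using permutes_inj[OF append_cycle_permutes[OF perm(1) *(1)]] by (metis injD Suc_inject)
    have "\<sigma> i = \<sigma>' i" for i
    proof (cases "i \<le> j")
      case True
      then show ?thesis using fun_cong[OF eq, of i] j by (simp add: append_cycle_def)
    next
      case False
      then show ?thesis using permutes_not_in[OF perm(1)] permutes_not_in[OF perm(2)] j by simp
    qed
    with j show "j = j' \<and> \<sigma> = \<sigma>'" by auto
  qed
  show "(\<lambda>(j, \<sigma>). append_cycle j N \<sigma>) ` (SIGMA j:{..<N}. S_b2 j) = S_b2 N"
    using append_cycle_in_S_b2 S_b2_eq_append_cycle[OF _ assms]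
    by (auto simp: image_iff) (metis SigmaI case_prod_conv lessThan_iff)
qed

section \<open>Cycle monomials\<close>

text \<open>Following the orbit of \<open>N\<close> downwards meets every point of the interval, so \<^const>\<open>append_cycle\<close>
  creates exactly one new cycle, and the cycle monomial gains one factor \<open>x_(N - j)\<close>.\<close>

lemma cyclic_on_append_cycle:
  assumes "\<sigma> permutes {1..j}" "j < N"
  shows "cyclic_on (append_cycle j N \<sigma>) {Suc j..N}"
proof -
  let ?p = "append_cycle j N \<sigma>"
  have "x \<in> {Suc j..N}" if "x \<in> orbit ?p N" for x
    using that assms(2) by induction (auto simp: append_cycle_def)
  moreover have "x \<in> orbit ?p N" if "Suc j \<le> x" "x \<le> N" for x
    using that(2,1)
  proof (induction rule: inc_induct)
    case base
    show ?case
      using append_cycle_permutes[OF assms]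
      by (intro permutation_self_in_orbit) (auto simp: permutation_permutes)
  next
    case (step x)
    then have "?p (Suc x) = x" by (auto simp: append_cycle_def)
    with step orbit.step[of "Suc x" ?p N] show ?case by simp
  qed
  ultimately have "{Suc j..N} = orbit ?p N"
    by (intro subset_antisym subsetI) (simp_all only: atLeastAtMost_iff)
  moreover have "N \<in> {Suc j..N}" using assms(2) by simp
  ultimately show ?thesis by (rule cyclic_on_singleI[rotated])
qed

lemma orbits_append_cycle:
  assumes "\<sigma> permutes {1..j}" "j < N"
  shows "orbit (append_cycle j N \<sigma>) ` {1..N} = insert {Suc j..N} (orbit \<sigma> ` {1..j})"
proof -
  let ?p = "append_cycle j N \<sigma>"
  have "orbit ?p a = {Suc j..N}" if "a \<in> {Suc j..N}" for a
    using that orbit_cyclic_eq3[OF cyclic_on_append_cycle[OF assms]] by blast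
  moreover have "orbit ?p a = orbit \<sigma> a" if "a \<in> {1..j}" for a
  proof (rule orbit_cong0[symmetric])
    show "\<sigma> \<in> {1..j} \<rightarrow> {1..j}" using permutes_in_image[OF assms(1)] by blast
  qed (use that in \<open>auto simp: append_cycle_def\<close>)
  ultimately have "orbit ?p ` {Suc j..N} = {{Suc j..N}}" "orbit ?p ` {1..j} = orbit \<sigma> ` {1..j}"
    using assms(2) by (auto simp: image_constant_conv cong: image_cong_simp)
  moreover have "{1..N} = {Suc j..N} \<union> {1..j}" using assms(2) by auto
  ultimately show ?thesis by (simp only: image_Un insert_is_Un[symmetric])
qed

lemma num_cycles_alt: "num_cycles A p i = card {C \<in> orbit p ` A. card C = i}"
  unfolding num_cycles_def by (rule arg_cong[of _ _ card]) auto

lemma num_cycles_append_cycle: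
  assumes "\<sigma> permutes {1..j}" "j < N"
  shows "num_cycles {1..N} (append_cycle j N \<sigma>) i =
         num_cycles {1..j} \<sigma> i + (if i = N - j then 1 else 0)"
proof -
  have "{Suc j..N} \<notin> orbit \<sigma> ` {1..j}"
    using permutes_orbit_subset[OF assms(1)] assms(2) by fastforce
  moreover have "{C \<in> insert {Suc j..N} (orbit \<sigma> ` {1..j}). card C = i} =
    (if i = N - j then insert {Suc j..N} {C \<in> orbit \<sigma> ` {1..j}. card C = i}
     else {C \<in> orbit \<sigma> ` {1..j}. card C = i})"
    by auto
  ultimately show ?thesis
    unfolding num_cycles_alt orbits_append_cycle[OF assms] by simp
qed

lemma num_cycles_eq_0:
  assumes "\<sigma> permutes {1..j}" "i > j"
  shows "num_cycles {1..j} \<sigma> i = 0"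
proof -
  have "card C \<le> j" if "C \<in> orbit \<sigma> ` {1..j}" for C
    using that permutes_orbit_subset[OF assms(1)] card_mono[of "{1..j}" C] by auto
  with assms(2) have "{C \<in> orbit \<sigma> ` {1..j}. card C = i} = {}" by force
  then show ?thesis by (simp only: num_cycles_alt card.empty)
qed

lemma cycle_monomial_append_cycle:
  assumes "\<sigma> permutes {1..j}" "j < N"
  shows "cycle_monomial N (append_cycle j N \<sigma>) =
         (mvar (N - j) * cycle_monomial j \<sigma> :: 'a::comm_semiring_1 mpoly)"
proof -
  have "cycle_monomial N (append_cycle j N \<sigma>) =
      (\<Prod>i\<in>{1..N}. mvar i ^ num_cycles {1..j} \<sigma> i * (if i = N - j then mvar i else 1 :: 'a mpoly))"
    unfolding cycle_monomial_def num_cycles_append_cycle[OF assms]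
    by (rule prod.cong) (auto simp: power_add)
  also have "\<dots> = (\<Prod>i\<in>{1..N}. mvar i ^ num_cycles {1..j} \<sigma> i) * mvar (N - j)"
    using assms(2) by (simp add: prod.distrib prod.delta)
  also have "(\<Prod>i\<in>{1..N}. mvar i ^ num_cycles {1..j} \<sigma> i :: 'a mpoly) = cycle_monomial j \<sigma>"
    unfolding cycle_monomial_def
    using assms(2) num_cycles_eq_0[OF assms(1)] by (intro prod.mono_neutral_right) auto
  finally show ?thesis by (simp add: mult.commute)
qed

lemma sum_cycle_monomial_0: "(\<Sum>\<pi>\<in>S_b2 0. cycle_monomial 0 \<pi>) = (1 :: 'a::comm_semiring_1 mpoly)"
  by (simp add: S_b2_def cycle_monomial_def)

lemma finite_S_b2: "finite (S_b2 N)"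
proof (rule finite_subset)
  show "S_b2 N \<subseteq> {\<pi>. \<pi> permutes {1..N}}" unfolding S_b2_def by blast
qed (simp add: finite_permutations)

lemma sum_cycle_monomial_rec:
  assumes "N > 0"
  shows "(\<Sum>\<pi>\<in>S_b2 N. cycle_monomial N \<pi>) =
         (\<Sum>j<N. mvar (N - j) * (\<Sum>\<sigma>\<in>S_b2 j. cycle_monomial j \<sigma>) :: 'a::comm_semiring_1 mpoly)"
proof -
  have "(\<Sum>\<pi>\<in>S_b2 N. cycle_monomial N \<pi> :: 'a mpoly) =
      (\<Sum>(j, \<sigma>)\<in>(SIGMA j:{..<N}. S_b2 j). cycle_monomial N (append_cycle j N \<sigma>))"
    by (simp add: sum.reindex_bij_betw[OF bij_betw_append_cycle[OF assms], symmetric] case_prod_unfold)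
  also have "\<dots> = (\<Sum>j<N. \<Sum>\<sigma>\<in>S_b2 j. cycle_monomial N (append_cycle j N \<sigma>))"
    by (rule sum.Sigma[symmetric]) (auto simp: finite_S_b2)
  also have "\<dots> = (\<Sum>j<N. \<Sum>\<sigma>\<in>S_b2 j. mvar (N - j) * cycle_monomial j \<sigma>)"
    by (intro sum.cong refl cycle_monomial_append_cycle) (auto simp: S_b2_def)
  finally show ?thesis by (simp add: sum_distrib_left)
qed

section \<open>Convergence of formal power series\<close>

unbundle fps_syntax

lemma sums_monomials_fps:
  fixes c :: "nat \<Rightarrow> 'a::comm_ring_1"
  shows "(\<lambda>n. fps_const (c n) * fps_X ^ Suc n) sums Abs_fps (\<lambda>k. if k = 0 then 0 else c (k - 1))"
  unfolding sums_def
proof (rule tendsto_fpsI)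
  fix k
  show "\<forall>\<^sub>F n in sequentially. (\<Sum>i<n. fps_const (c i) * fps_X ^ Suc i) $ k =
           Abs_fps (\<lambda>k. if k = 0 then 0 else c (k - 1)) $ k"
    using eventually_ge_at_top[of k]
  proof eventually_elim
    case (elim n)
    have "(\<Sum>i<n. fps_const (c i) * fps_X ^ Suc i) $ k = (\<Sum>i<n. if Suc i = k then c i else 0)"
      unfolding fps_sum_nth fps_mult_left_const_nth fps_X_power_nth
      by (rule sum.cong) auto
    also have "\<dots> = (if k = 0 then 0 else c (k - 1))"
    proof (cases k)
      case (Suc k')
      with elim show ?thesis by (simp add: sum.delta')
    qed simp
    finally show ?case by simp
  qed
qed

text \<open>This is the geometric series, without dividing by \<open>1 - f\<close>: over a ring the equation
  \<open>g = f + f g\<close> makes the partial sums equal to \<open>g - f\<^sup>n g\<close>, and \<open>f\<^sup>n g\<close> tends to 0 because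
  its first \<open>n\<close> coefficients vanish.\<close>

lemma sums_powers_fps:
  fixes f g :: "'a::comm_ring_1 fps"
  assumes "f $ 0 = 0" "g = f + f * g"
  shows "(\<lambda>k. f ^ Suc k) sums g"
  unfolding sums_def
proof (rule tendsto_fpsI)
  fix k
  have partial: "(\<Sum>i<n. f ^ Suc i) = g - f ^ n * g" for n
  proof (induction n)
    case (Suc n)
    have "f ^ n * g = f ^ Suc n + f ^ Suc n * g"
      by (subst assms(2)) (simp add: algebra_simps)
    moreover have "(\<Sum>i<Suc n. f ^ Suc i) = g - f ^ n * g + f ^ Suc n"
      unfolding sum.lessThan_Suc Suc ..
    ultimately show ?case by (simp only:) simp
  qed simp
  show "\<forall>\<^sub>F n in sequentially. (\<Sum>i<n. f ^ Suc i) $ k = g $ k"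
    using eventually_gt_at_top[of k]
  proof eventually_elim
    case (elim n)
    have "(f ^ n * g) $ k = 0"
      using startsby_zero_power_prefix[OF assms(1), of n] elim
      by (auto simp: fps_mult_nth intro!: sum.neutral)
    then show ?case by (simp only: partial fps_sub_nth diff_zero)
  qed
qed

section \<open>The generating function\<close>

theorem theorem2p7:
  fixes u half :: "'a::field_char_0 mpoly fps" and l r :: "nat \<Rightarrow> 'a mpoly fps"
  defines "u \<equiv> fps_X"
    and "half \<equiv> fps_const (mconst (1 / 2))"
    and "l \<equiv> (\<lambda>n. half ^ n * u ^ (n + 1) *
               fps_const (\<Sum>\<pi>\<in>S_b2 (n + 1). cycle_monomial (n + 1) \<pi>))"
    and "r \<equiv> (\<lambda>i. fps_const (mvar (i + 1)) * (half * u) ^ (i + 1))"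
  shows "summable l \<and> summable r \<and> summable (\<lambda>k. suminf r ^ (k + 1)) \<and>
         suminf l = 2 * suminf (\<lambda>k. suminf r ^ (k + 1))"
proof -
  define h :: "'a mpoly" where "h = mconst (1 / 2)"
  define P :: "nat \<Rightarrow> 'a mpoly" where "P N = (\<Sum>\<pi>\<in>S_b2 N. cycle_monomial N \<pi>)" for N
  define R where "R = Abs_fps (\<lambda>k. if k = 0 then 0 else mvar k * h ^ k)"
  \<comment> \<open>This is \<open>Q - 1\<close> for the series \<open>Q\<close> of the \<open>(u/2)^N P N\<close>.\<close>
  define G where "G = Abs_fps (\<lambda>k. if k = 0 then 0 else h ^ k * P k)"
  have two_h: "2 * h = 1"
  proof -
    have "2 * h = h + h" by simp
    also have "\<dots> = Poly_Mapping.single 0 (1 / 2 + 1 / 2)"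
      unfolding h_def mconst_def by (rule single_add[symmetric])
    finally show ?thesis by simp
  qed
  have "l = (\<lambda>n. fps_const (h ^ n * P (Suc n)) * fps_X ^ Suc n)"
    unfolding l_def half_def u_def P_def h_def
    by (simp add: fun_eq_iff fps_const_power ac_simps flip: fps_const_mult)
  then have l: "l sums Abs_fps (\<lambda>k. if k = 0 then 0 else h ^ (k - 1) * P (Suc (k - 1)))"
    by (simp only: sums_monomials_fps[of "\<lambda>n. h ^ n * P (Suc n)"])
  have "Abs_fps (\<lambda>k. if k = 0 then 0 else h ^ (k - 1) * P (Suc (k - 1))) = 2 * G"
  proof (rule fps_ext)
    fix k
    have nth: "(2 * G) $ k = 2 * G $ k" by (simp only: mult_2 fps_add_nth)
    show "Abs_fps (\<lambda>k. if k = 0 then 0 else h ^ (k - 1) * P (Suc (k - 1))) $ k = (2 * G) $ k"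
    proof (cases k)
      case (Suc k')
      have "(2 * G) $ k = (2 * h) * (h ^ k' * P k)"
        unfolding nth using Suc by (simp add: G_def mult.assoc)
      with Suc two_h show ?thesis by simp
    qed (use nth in \<open>simp add: G_def\<close>)
  qed
  with l have l: "l sums (2 * G)" by simp
  have "r = (\<lambda>n. fps_const (mvar (Suc n) * h ^ Suc n) * fps_X ^ Suc n)"
    unfolding r_def half_def u_def h_def power_mult_distrib fps_const_power
    by (simp add: fun_eq_iff ac_simps flip: fps_const_mult)
  then have "r sums Abs_fps (\<lambda>k. if k = 0 then 0 else mvar (Suc (k - 1)) * h ^ Suc (k - 1))"
    by (simp only: sums_monomials_fps[of "\<lambda>n. mvar (Suc n) * h ^ Suc n"])
  also have "Abs_fps (\<lambda>k. if k = 0 then 0 else mvar (Suc (k - 1)) * h ^ Suc (k - 1)) = R"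
    by (auto simp: R_def fps_eq_iff)
  finally have r: "r sums R" .
  \<comment> \<open>The equation \<open>Q = 1 + R Q\<close>, read off coefficientwise from the recurrence.\<close>
  have "G = R + R * G"
  proof (rule fps_ext)
    fix N
    show "G $ N = (R + R * G) $ N"
    proof (cases "N = 0")
      case False
      have P0: "P 0 = 1" by (simp add: P_def sum_cycle_monomial_0)
      have "G + 1 = Abs_fps (\<lambda>k. h ^ k * P k)"
        by (auto simp: G_def fps_eq_iff P0)
      moreover have "R + R * G = (G + 1) * R" by (simp add: algebra_simps)
      ultimately have "(R + R * G) $ N = (Abs_fps (\<lambda>k. h ^ k * P k) * R) $ N" by (simp only:)
      also have "\<dots> = (\<Sum>j<N. h ^ j * P j * (mvar (N - j) * h ^ (N - j)))"
        unfolding fps_mult_nth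
        by (intro sum.mono_neutral_cong_right) (auto simp: R_def)
      also have "\<dots> = (\<Sum>j<N. h ^ N * (mvar (N - j) * P j))"
      proof (rule sum.cong)
        fix j assume "j \<in> {..<N}"
        then have "h ^ N = h ^ j * h ^ (N - j)" by (simp flip: power_add)
        then show "h ^ j * P j * (mvar (N - j) * h ^ (N - j)) = h ^ N * (mvar (N - j) * P j)"
          by (simp only: ac_simps)
      qed simp
      also have "\<dots> = h ^ N * P N"
        using False by (simp add: P_def sum_cycle_monomial_rec flip: sum_distrib_left)
      finally show ?thesis using False by (simp add: G_def)
    qed (simp add: G_def R_def)
  qed
  then have g: "(\<lambda>k. R ^ (k + 1)) sums G"
    using sums_powers_fps[of R G] by (simp add: R_def)
  show ?thesis
    using l r g by (simp add: sums_iff)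
qed

end
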